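(* Let $N\ge 1$ and let $x_1,\dots,x_{N-1}\in[0,1)$ be such that $x_N:=1-\sum_{i=1}^{N-1}x_i>0$. For every $\pi\in\mathfrak{S}_N$, the probability $R(\pi)$ that the relative ordering $\pi$ occurs in the reselect experiment with parameters $x_1,\dots,x_N$ is $$R(\pi)=\frac{1}{\prod_{i=1}^N (x_i+x_{i+1}+\cdots+x_N)}\sum_{\substack{\text{Dyck paths } p\\ p\succcurlyeq \mathrm{BTM_{PATH}}(\pi)}}\frac{\prod_{i=1}^N x_{p_i}}{\prod_{j=1}^N p^{(j)}!}$$ $$=\frac{1}{N!\,\prod_{i=1}^N (x_i+x_{i+1}+\cdots+x_N)}\sum_{\substack{\text{integer sequences } w\\ w\unrhd \mathrm{BTM_{WORD}}(\pi)}}\ \prod_{i=1}^N x_{w_i}.$$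
   Context: Reselect experiment: independently for $i=1,\dots,N$ choose a real number (height) $y_i$ uniformly at random from the interval of length $x_i+x_{i+1}+\cdots+x_N$ with right endpoint $1$. Almost surely the $y_i$ are distinct; the relative ordering is the permutation $\pi\in\mathfrak{S}_N$ with $\pi(i)=$ rank of $y_i$ among $y_1,\dots,y_N$ (rank $1$ is the smallest). $R(\pi)$ is the probability that this permutation is $\pi$. $\pi(i)$ is the value at position $i$ and $\pi^{-1}(j)$ is the position of value $j$. A bottom-to-top maximum of $\pi$ is an entry whose position is to the right of the positions of all entries having smaller value (value $1$ always is one). $\mathrm{BTM_{WORD}}(\pi)=(m_1,\dots,m_N)$, where $m_1=\pi^{-1}(1)$ and, for $i\ge2$, $m_i=\pi^{-1}(i)$ if the value $i$ is a bottom-to-top maximum of $\pi$, and $m_i=m_{i-1}$ otherwise. A Dyck path is a lattice path from $(0,0)$ to $(N,N)$ with steps $(0,1)$ and $(1,0)$ staying weakly above the line $y=x$. For a Dyck path $p$, $p_i$ is the height of its horizontal step in the $i$th column (from abscissa $i-1$ to $i$), and $p^{(j)}$ is the number of horizontal steps of $p$ at height $j$. $\mathrm{BTM_{PATH}}(\pi)$ is the Dyck path whose height in column $i$ is $m_i$ for each $i$. For Dyck paths $p,q$, $p\succcurlyeq q$ means that $p$ lies weakly above $q$, i.e. $p_i\ge q_i$ for all $i$. For integer sequences $w,v$ of length $N$, $w\unrhd v$ means that the non-decreasing rearrangement $(w_{(1)},\dots,w_{(N)})$ of $w$ satisfies $N\ge w_{(i)}\ge v_i$ for each $i$. *)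

theory Defs
  imports "HOL-Probability.Probability" "HOL-Combinatorics.Permutations"
begin

text \<open>Positions, values and columns are numbered from 1; list positions are numbered from 0.
  Permutations are functions \<open>\<pi>\<close> with \<open>\<pi> permutes {1..N}\<close>, and \<open>inv \<pi> j\<close> is the position
  of the value \<open>j\<close>.\<close>

section \<open>The reselect experiment\<close>

definition tail_sum :: "nat \<Rightarrow> (nat \<Rightarrow> real) \<Rightarrow> nat \<Rightarrow> real" where
  "tail_sum N x i = (\<Sum>k=i..N. x k)"

definition reselect_measure :: "nat \<Rightarrow> (nat \<Rightarrow> real) \<Rightarrow> (nat \<Rightarrow> real) measure" where
  "reselect_measure N x =
     (\<Pi>\<^sub>M i\<in>{1..N}. uniform_measure lborel {1 - tail_sum N x i..1})"

definition rank_of :: "nat \<Rightarrow> (nat \<Rightarrow> real) \<Rightarrow> nat \<Rightarrow> nat" where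
  "rank_of N y i = card {j \<in> {1..N}. y j \<le> y i}"

definition reselect_prob :: "nat \<Rightarrow> (nat \<Rightarrow> real) \<Rightarrow> (nat \<Rightarrow> nat) \<Rightarrow> real" where
  "reselect_prob N x \<pi> =
     measure (reselect_measure N x)
       {y \<in> space (reselect_measure N x). \<forall>i\<in>{1..N}. rank_of N y i = \<pi> i}"

section \<open>Bottom-to-top maxima\<close>

definition btm_maximum :: "(nat \<Rightarrow> nat) \<Rightarrow> nat \<Rightarrow> bool" where
  "btm_maximum \<pi> i \<longleftrightarrow> (\<forall>j\<in>{1..<i}. inv \<pi> j < inv \<pi> i)"

text \<open>\<open>btm_entry \<pi> i\<close> is $m_i$; the value at \<open>i = 0\<close> is a dummy, never used because 1 is always
  a bottom-to-top maximum.\<close>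

fun btm_entry :: "(nat \<Rightarrow> nat) \<Rightarrow> nat \<Rightarrow> nat" where
  "btm_entry \<pi> 0 = 0"
| "btm_entry \<pi> (Suc i) =
     (if btm_maximum \<pi> (Suc i) then inv \<pi> (Suc i) else btm_entry \<pi> i)"

definition btm_word :: "nat \<Rightarrow> (nat \<Rightarrow> nat) \<Rightarrow> int list" where
  "btm_word N \<pi> = map (\<lambda>i. int (btm_entry \<pi> i)) [1..<Suc N]"

section \<open>Dyck paths\<close>

datatype lattice_step = North | East

text \<open>It suffices to compare with the line $y = x$ at the lattice points of the path.\<close>

definition dyck_path :: "nat \<Rightarrow> lattice_step list \<Rightarrow> bool" where
  "dyck_path N p \<longleftrightarrow> count_list p North = N \<and> count_list p East = N \<and>
     (\<forall>k\<le>length p. count_list (take k p) East \<le> count_list (take k p) North)"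

text \<open>Heights of the horizontal steps, from left to right, of a path that starts at height \<open>h\<close>.\<close>

fun east_heights :: "nat \<Rightarrow> lattice_step list \<Rightarrow> nat list" where
  "east_heights h [] = []"
| "east_heights h (North # p) = east_heights (Suc h) p"
| "east_heights h (East # p) = h # east_heights h p"

definition column_height :: "lattice_step list \<Rightarrow> nat \<Rightarrow> nat" where
  "column_height p i = east_heights 0 p ! (i - 1)"

definition steps_at_height :: "lattice_step list \<Rightarrow> nat \<Rightarrow> nat" where
  "steps_at_height p j = count_list (east_heights 0 p) j"

definition weakly_above :: "nat \<Rightarrow> lattice_step list \<Rightarrow> lattice_step list \<Rightarrow> bool" where
  "weakly_above N p q \<longleftrightarrow> (\<forall>i\<in>{1..N}. column_height p i \<ge> column_height q i)"

definition btm_path :: "nat \<Rightarrow> (nat \<Rightarrow> nat) \<Rightarrow> lattice_step list" where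
  "btm_path N \<pi> =
     (THE p. dyck_path N p \<and> (\<forall>i\<in>{1..N}. column_height p i = btm_entry \<pi> i))"

section \<open>Dominance of integer sequences\<close>

definition dominates :: "nat \<Rightarrow> int list \<Rightarrow> int list \<Rightarrow> bool" where
  "dominates N w v \<longleftrightarrow> length w = N \<and> length v = N \<and>
     (\<forall>i<N. int N \<ge> sort w ! i \<and> sort w ! i \<ge> v ! i)"

end

theory Submission
  imports Defs "HOL-Combinatorics.Multiset_Permutations"
begin

text \<open>
  Let \<open>b i = x 1 + \<dots> + x (i - 1)\<close>. The experiment is a uniform point \<open>y\<close> of the unit cube
  conditioned on \<open>b i \<le> y i\<close> for all \<open>i\<close>, an event of probability \<open>\<Prod>i. tail_sum N x i\<close>. If \<open>y\<close> has
  ordering \<open>\<pi>\<close> and \<open>z 1 < \<dots> < z N\<close> are its sorted coordinates, the condition says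
  \<open>b (inv \<pi> j) \<le> z j\<close> for all \<open>j\<close>; as \<open>z\<close> increases this is the same as \<open>b (m j) \<le> z j\<close>, where
  \<open>m j\<close> is the maximum of \<open>inv \<pi> k\<close> over \<open>k \<le> j\<close>, the \<open>j\<close>-th entry of the bottom-to-top word.
  The latter condition is symmetric in the coordinates of \<open>y\<close>, so its probability together with any one
  of the \<open>N!\<close> orderings is the same. Cutting the unit interval at the points \<open>b k\<close> into cells of
  length \<open>x k\<close> and recording the cell of each coordinate turns it into dominance of a
  word \<open>w\<close>, whose box has volume \<open>\<Prod>i. x (w i)\<close>. Sorted dominating words are the height
  sequences of the Dyck paths above the bottom-to-top path, and the multinomial coefficient counts the
  rearrangements of each.
\<close>

section \<open>Words above a height sequence\<close>

text \<open>Columns are numbered from 1 and list positions from 0, hence \<open>m (Suc i)\<close>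
  against \<open>s ! i\<close>. For \<open>m = btm_entry \<pi>\<close> these lists are the height
  sequences of the Dyck paths above the bottom-to-top path.\<close>

definition sorted_words :: "nat \<Rightarrow> (nat \<Rightarrow> nat) \<Rightarrow> nat list set" where
  "sorted_words N m = {s. length s = N \<and> sorted s \<and> (\<forall>i<N. m (Suc i) \<le> s ! i \<and> s ! i \<le> N)}"

text \<open>Dominance for words of natural numbers, whose letters serve directly as cell
  numbers.\<close>

definition words_above :: "nat \<Rightarrow> (nat \<Rightarrow> nat) \<Rightarrow> nat list set" where
  "words_above N m = {w. sort w \<in> sorted_words N m}"

lemma finite_sorted_words: "finite (sorted_words N m)"
  by (rule finite_subset[OF _ finite_lists_length_eq[of "{..N}" N]])
     (auto simp: sorted_words_def in_set_conv_nth)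

text \<open>The bound \<open>i \<le> m i\<close> makes every sorted entry at least 1, so each letter
  is a valid cell number.\<close>

lemma words_above_subset:
  assumes "\<forall>i\<in>{1..N}. i \<le> m i"
  shows "words_above N m \<subseteq> {w. set w \<subseteq> {1..N} \<and> length w = N}"
proof
  fix w assume w: "w \<in> words_above N m"
  have "set (sort w) \<subseteq> {1..N}"
  proof
    fix a assume "a \<in> set (sort w)"
    then obtain i where i: "i < length (sort w)" "a = sort w ! i"
      by (metis in_set_conv_nth)
    with w have "m (Suc i) \<le> a" "a \<le> N" "i < N"
      by (auto simp: words_above_def sorted_words_def)
    with bspec[OF assms, of "Suc i"] show "a \<in> {1..N}" by auto
  qed
  with w show "w \<in> {w. set w \<subseteq> {1..N} \<and> length w = N}"
    by (auto simp: words_above_def sorted_words_def)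
qed

lemma finite_words_above:
  assumes "\<forall>i\<in>{1..N}. i \<le> m i"
  shows "finite (words_above N m)"
  using words_above_subset[OF assms] finite_lists_length_eq[of "{1..N}" N]
  by (auto intro: finite_subset)

lemma prod_nth_eq_prod_list:
  "(\<Prod>i<length w. x (w ! i)) = prod_list (map x w)" for x :: "'a \<Rightarrow> 'b::comm_monoid_mult"
  by (simp add: prod.list_conv_set_nth atLeast0LessThan)

lemma prod_list_map_sort:
  "prod_list (map x (sort w)) = prod_list (map x w)" for x :: "'a::linorder \<Rightarrow> 'b::comm_monoid_mult"
proof -
  have "mset (map x (sort w)) = mset (map x w)" by simp
  thus ?thesis by (metis prod_mset_prod_list)
qed

text \<open>Group the words by their sorted rearrangement. The weight is constant on each group, and
  a group consists of the permutations of one multiset, counted by a multinomial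
  coefficient.\<close>

lemma sum_words_above:
  fixes x :: "nat \<Rightarrow> real"
  assumes m: "\<forall>i\<in>{1..N}. i \<le> m i"
  shows "(\<Sum>w\<in>words_above N m. prod_list (map x w)) =
    fact N * (\<Sum>s\<in>sorted_words N m. prod_list (map x s) / (\<Prod>j=1..N. fact (count_list s j)))"
proof -
  have "(\<Sum>w\<in>words_above N m. prod_list (map x w)) =
    (\<Sum>s\<in>sorted_words N m. \<Sum>w\<in>{w\<in>words_above N m. sort w = s}. prod_list (map x w))"
    by (rule sum.group[symmetric, OF finite_words_above[OF m] finite_sorted_words])
       (auto simp: words_above_def)
  also have "\<dots> = (\<Sum>s\<in>sorted_words N m.
      fact N * (prod_list (map x s) / (\<Prod>j=1..N. fact (count_list s j))))"
  proof (rule sum.cong[OF refl])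
    fix s assume s: "s \<in> sorted_words N m"
    hence "sorted s" and len: "length s = N" by (auto simp: sorted_words_def)
    have "sort w = s \<longleftrightarrow> mset w = mset s" for w
      using \<open>sorted s\<close> properties_for_sort[of s w] by (metis mset_sort)
    moreover have "{w\<in>words_above N m. sort w = s} = {w. sort w = s}"
      using s by (auto simp: words_above_def)
    ultimately have eq: "{w\<in>words_above N m. sort w = s} = permutations_of_multiset (mset s)"
      by (simp add: permutations_of_multiset_def)
    have "s \<in> words_above N m" using s \<open>sorted s\<close> by (simp add: words_above_def sorted_sort_id)
    hence "set s \<subseteq> {1..N}" using words_above_subset[OF m] by blast
    \<comment> \<open>Numbers that do not occur in \<open>s\<close> contribute the factor
      \<open>fact 0 = 1\<close>.\<close>
    hence prod: "(\<Prod>a\<in>set_mset (mset s). fact (count (mset s) a) :: nat) =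
        (\<Prod>j=1..N. fact (count_list s j))"
      by (intro prod.mono_neutral_cong_left) (auto simp: count_mset count_list_0_iff)
    have "real (card (permutations_of_multiset (mset s))) *
        (\<Prod>j=1..N. fact (count_list s j)) = fact N"
      using arg_cong[OF card_permutations_of_multiset_aux[of "mset s"], of real]
      unfolding prod by (simp add: len)
    moreover have "(\<Prod>j=1..N. fact (count_list s j) :: real) \<noteq> 0" by simp
    ultimately have card: "real (card (permutations_of_multiset (mset s))) =
        fact N / (\<Prod>j=1..N. fact (count_list s j))"
      by (simp add: field_simps)
    have "(\<Sum>w\<in>{w\<in>words_above N m. sort w = s}. prod_list (map x w)) =
        (\<Sum>w\<in>{w\<in>words_above N m. sort w = s}. prod_list (map x s))"
      by (intro sum.cong) (auto simp: prod_list_map_sort)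
    thus "(\<Sum>w\<in>{w\<in>words_above N m. sort w = s}. prod_list (map x w)) =
        fact N * (prod_list (map x s) / (\<Prod>j=1..N. fact (count_list s j)))"
      by (simp add: eq card)
  qed
  finally show ?thesis by (simp add: sum_distrib_left)
qed

lemma sort_map_int: "sort (map int w) = map int (sort w)"
  by (rule properties_for_sort) (auto simp: sorted_map intro: sorted_wrt_mono_rel[OF _ sorted_sort])

text \<open>No integer sequence is lost by passing to natural numbers: every entry of a dominating
  sequence is bounded below by some \<open>int (m i)\<close>, so it is nonnegative and
  \<open>nat\<close> inverts the cast.\<close>

lemma bij_betw_words_above_dominates:
  assumes m: "\<forall>i\<in>{1..N}. i \<le> m i"
  shows "bij_betw (map int) (words_above N m)
    {w. dominates N w (map (\<lambda>i. int (m i)) [1..<Suc N])}"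
proof -
  have nth: "map (\<lambda>i. int (m i)) [1..<Suc N] ! i = int (m (Suc i))" if "i < N" for i
    using that by (simp add: nth_append del: upt_Suc)
  have dom: "dominates N (map int w) (map (\<lambda>i. int (m i)) [1..<Suc N]) \<longleftrightarrow> w \<in> words_above N m"
    for w
    by (auto simp: dominates_def words_above_def sorted_words_def sort_map_int nth simp del: upt_Suc)
  have "w \<in> map int ` words_above N m" if w: "dominates N w (map (\<lambda>i. int (m i)) [1..<Suc N])"
    for w
  proof -
    have "a \<ge> 0" if "a \<in> set w" for a
    proof -
      from that have "a \<in> set (sort w)" by simp
      then obtain i where "i < length (sort w)" "a = sort w ! i" by (metis in_set_conv_nth)
      with w nth[of i] show ?thesis
        by (auto simp: dominates_def simp del: upt_Suc intro: order.trans[rotated])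
    qed
    hence "w = map int (map nat w)" by (simp add: map_idI)
    with w dom[of "map nat w"] show ?thesis by (metis imageI)
  qed
  moreover have "inj_on (map int) (words_above N m)"
    by (rule inj_on_subset[of _ UNIV]) (simp_all add: inj_mapI)
  ultimately show ?thesis unfolding bij_betw_def using dom by auto
qed

section \<open>Dyck paths and their heights\<close>

text \<open>A right inverse of \<open>east_heights\<close> on sorted lists: climb to each prescribed
  height just before its horizontal step, and to \<open>N\<close> at the end.\<close>

fun path_of_heights :: "nat \<Rightarrow> nat \<Rightarrow> nat list \<Rightarrow> lattice_step list" where
  "path_of_heights N h [] = replicate (N - h) North"
| "path_of_heights N h (a # s) = replicate (a - h) North @ East # path_of_heights N a s"

lemma east_heights_replicate_North:
  "east_heights h (replicate k North @ p) = east_heights (h + k) p"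
  by (induction k arbitrary: h) auto

lemma east_heights_path_of_heights:
  "sorted (h # s) \<Longrightarrow> east_heights h (path_of_heights N h s) = s"
  using east_heights_replicate_North[where p = "[]"]
  by (induction s arbitrary: h) (auto simp: east_heights_replicate_North)

lemma count_list_replicate: "count_list (replicate k a) b = (if a = b then k else 0)"
  by (induction k) auto

lemma count_North_path_of_heights:
  "sorted (h # s) \<Longrightarrow> h \<le> N \<Longrightarrow> set s \<subseteq> {..N} \<Longrightarrow>
    count_list (path_of_heights N h s) North = N - h"
  by (induction s arbitrary: h) (auto simp: count_list_replicate)

lemma length_east_heights: "length (east_heights h p) = count_list p East"
  by (induction h p rule: east_heights.induct) auto

lemma set_east_heights: "set (east_heights h p) \<subseteq> {h..h + count_list p North}"
  by (induction h p rule: east_heights.induct) fastforce+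

lemma sorted_east_heights: "sorted (east_heights h p)"
proof (induction h p rule: east_heights.induct)
  case (3 h p)
  thus ?case using set_east_heights[of h p] by auto
qed auto

text \<open>The heights do not see the vertical steps after the last horizontal one; the number of
  North steps recovers them.\<close>

lemma east_heights_inject:
  assumes "east_heights h p = east_heights h q" "count_list p North = count_list q North"
  shows "p = q"
  using assms
proof (induction p arbitrary: h q)
  case Nil
  thus ?case
  proof (cases q)
    case (Cons s q')
    with Nil show ?thesis by (cases s) auto
  qed simp
next
  case (Cons s p)
  \<comment> \<open>After a North step all heights exceed \<open>h\<close>, so whether the list
    begins with \<open>h\<close> reveals the first step of the path.\<close>
  have neq: "east_heights (Suc h) r \<noteq> h # l" for h r l
    using set_east_heights[of "Suc h" r] by auto
  show ?case
  proof (cases q)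
    case Nil
    with Cons.prems show ?thesis by (cases s) auto
  next
    case (Cons s' q')
    with Cons.prems Cons.IH[of "Suc h" q'] Cons.IH[of h q'] neq[of h] show ?thesis
      by (cases s; cases s') (auto, metis)
  qed
qed

text \<open>Generalized to a path that starts at the lattice point \<open>(e, h)\<close>.\<close>

lemma prefixes_above_diagonal_iff:
  assumes "e \<le> h"
  shows "(\<forall>k\<le>length p. e + count_list (take k p) East \<le> h + count_list (take k p) North) \<longleftrightarrow>
    (\<forall>i<count_list p East. e + i < east_heights h p ! i)"
  using assms
proof (induction p arbitrary: e h)
  case (Cons s p)
  have split: "(\<forall>k\<le>length (s # p). P k) \<longleftrightarrow> P 0 \<and> (\<forall>k\<le>length p. P (Suc k))" for P
    by (simp flip: less_Suc_eq_le add: All_less_Suc2)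
  have split': "(\<forall>i<Suc n. P i) \<longleftrightarrow> P 0 \<and> (\<forall>i<n. P (Suc i))" for P n
    by (auto simp: less_Suc_eq_0_disj)
  show ?case
  proof (cases s)
    case North
    with Cons.IH[of e "Suc h"] Cons.prems show ?thesis unfolding split by simp
  next
    case East
    show ?thesis
    proof (cases "e < h")
      case True
      with Cons.IH[of "Suc e" h] East show ?thesis unfolding split by (simp add: split')
    next
      case False
      \<comment> \<open>Here \<open>e = h\<close>, so the East step crosses the diagonal at once:
        the left side fails at \<open>k = 1\<close>, the right side at \<open>i = 0\<close>.\<close>
      have "\<not> (\<forall>k\<le>length (s # p). e + count_list (take k (s # p)) East \<le> h + count_list (take k (s # p)) North)"
        using False East unfolding split by auto
      with False East show ?thesis by (auto simp: split')
    qed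
  qed
qed simp

text \<open>Vertical steps lead away from the diagonal, so only horizontal steps need checking. The
  inequality is strict because the step in column \<open>i + 1\<close> ends at abscissa
  \<open>i + 1\<close>.\<close>

lemma dyck_path_iff:
  "dyck_path N p \<longleftrightarrow> count_list p North = N \<and> count_list p East = N \<and>
     (\<forall>i<N. i < east_heights 0 p ! i)"
  using prefixes_above_diagonal_iff[of 0 0 p] by (auto simp: dyck_path_def)

text \<open>Conversely to reading off heights, a sorted word above \<open>m\<close> satisfies
  \<open>s ! i \<ge> m (Suc i) \<ge> Suc i\<close>, so the path built from it stays above the
  diagonal without further conditions.\<close>

lemma bij_betw_dyck_path_sorted_words:
  assumes m: "\<forall>i\<in>{1..N}. i \<le> m i"
  shows "bij_betw (east_heights 0) {p. dyck_path N p \<and> (\<forall>i\<in>{1..N}. m i \<le> column_height p i)}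
    (sorted_words N m)"
proof (rule bij_betwI')
  fix p q
  assume "p \<in> {p. dyck_path N p \<and> (\<forall>i\<in>{1..N}. m i \<le> column_height p i)}"
    and "q \<in> {p. dyck_path N p \<and> (\<forall>i\<in>{1..N}. m i \<le> column_height p i)}"
  thus "(east_heights 0 p = east_heights 0 q) = (p = q)"
    using east_heights_inject[of 0 p q] by (auto simp: dyck_path_iff)
next
  fix p assume p: "p \<in> {p. dyck_path N p \<and> (\<forall>i\<in>{1..N}. m i \<le> column_height p i)}"
  have "m (Suc i) \<le> east_heights 0 p ! i \<and> east_heights 0 p ! i \<le> N" if i: "i < N" for i
  proof
    from p i have "m (Suc i) \<le> column_height p (Suc i)" by auto
    thus "m (Suc i) \<le> east_heights 0 p ! i" by (simp add: column_height_def)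
    have "east_heights 0 p ! i \<in> set (east_heights 0 p)"
      using p i by (auto simp: length_east_heights dyck_path_iff)
    thus "east_heights 0 p ! i \<le> N"
      using set_east_heights[of 0 p] p by (auto simp: dyck_path_iff)
  qed
  with p show "east_heights 0 p \<in> sorted_words N m"
    by (auto simp: sorted_words_def length_east_heights dyck_path_iff sorted_east_heights)
next
  fix s assume s: "s \<in> sorted_words N m"
  define p where "p = path_of_heights N 0 s"
  from s have "sorted (0 # s)" "set s \<subseteq> {..N}" "length s = N"
    by (auto simp: sorted_words_def in_set_conv_nth)
  hence eq: "east_heights 0 p = s" and North: "count_list p North = N"
    using east_heights_path_of_heights count_North_path_of_heights[of 0 s N] by (auto simp: p_def)
  have nth: "m (Suc i) \<le> s ! i" if "i < N" for i using s that by (auto simp: sorted_words_def)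
  have "m i \<le> column_height p i" if "i \<in> {1..N}" for i
    using nth[of "i - 1"] that by (auto simp: column_height_def eq)
  moreover have "i < s ! i" if "i < N" for i
    using nth[of i] bspec[OF m, of "Suc i"] that by auto
  ultimately have "p \<in> {p. dyck_path N p \<and> (\<forall>i\<in>{1..N}. m i \<le> column_height p i)}"
    using North \<open>length s = N\<close> length_east_heights[of 0 p] by (auto simp: dyck_path_iff eq)
  with eq show "\<exists>p\<in>{p. dyck_path N p \<and> (\<forall>i\<in>{1..N}. m i \<le> column_height p i)}. s = east_heights 0 p"
    by blast
qed

lemma prod_column_height:
  assumes "dyck_path N p"
  shows "(\<Prod>i=1..N. x (column_height p i)) = prod_list (map x (east_heights 0 p))"
proof -
  have "(\<Prod>i=1..N. x (column_height p i)) = (\<Prod>i<N. x (column_height p (Suc i)))"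
    by (simp add: prod.atLeast1_atMost_eq)
  also have "\<dots> = (\<Prod>i<length (east_heights 0 p). x (east_heights 0 p ! i))"
    using assms by (simp add: column_height_def length_east_heights dyck_path_iff)
  finally show ?thesis by (simp only: prod_nth_eq_prod_list)
qed

section \<open>Bottom-to-top maxima\<close>

text \<open>A bottom-to-top maximum is a record of the positions \<open>inv \<pi> 1\<close>,
  \<open>inv \<pi> 2\<close>, and so on, so \<open>btm_entry\<close> is their running maximum: an
  upper bound that is attained.\<close>

lemma btm_entry_Max:
  "(\<forall>k\<in>{1..i}. inv \<pi> k \<le> btm_entry \<pi> i) \<and> (i > 0 \<longrightarrow> (\<exists>k\<in>{1..i}. btm_entry \<pi> i = inv \<pi> k))"
proof (induction i)
  case (Suc i)
  show ?case
  proof (cases "btm_maximum \<pi> (Suc i)")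
    case True
    hence "inv \<pi> k \<le> inv \<pi> (Suc i)" if "k \<in> {1..Suc i}" for k
      using that by (cases "k = Suc i") (auto simp: btm_maximum_def le_less)
    with True show ?thesis by auto
  next
    case False
    then obtain j where j: "j \<in> {1..i}" "inv \<pi> (Suc i) \<le> inv \<pi> j"
      by (force simp: btm_maximum_def)
    moreover from Suc.IH j(1) have "inv \<pi> j \<le> btm_entry \<pi> i" by blast
    ultimately have "inv \<pi> (Suc i) \<le> btm_entry \<pi> i" by linarith
    hence "inv \<pi> k \<le> btm_entry \<pi> i" if "k \<in> {1..Suc i}" for k
      using Suc.IH that by (cases "k = Suc i") auto
    \<comment> \<open>The witness \<open>j\<close> forces \<open>i > 0\<close>, which gives access
      to the attainment part of the induction hypothesis.\<close>
    moreover have "\<exists>k\<in>{1..i}. btm_entry \<pi> i = inv \<pi> k" using Suc.IH j by auto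
    hence "\<exists>k\<in>{1..Suc i}. btm_entry \<pi> i = inv \<pi> k" by force
    ultimately show ?thesis using False by simp
  qed
qed simp

lemma inv_le_btm_entry: "1 \<le> k \<Longrightarrow> k \<le> i \<Longrightarrow> inv \<pi> k \<le> btm_entry \<pi> i"
  using btm_entry_Max[of i \<pi>] by auto

lemma btm_entry_obtain:
  assumes "1 \<le> i"
  obtains k where "1 \<le> k" "k \<le> i" "btm_entry \<pi> i = inv \<pi> k"
  using btm_entry_Max[of i \<pi>] assms by auto

lemma btm_entry_mono:
  assumes "1 \<le> i" "i \<le> j"
  shows "btm_entry \<pi> i \<le> btm_entry \<pi> j"
  using assms by (metis btm_entry_obtain inv_le_btm_entry order.trans)

text \<open>Pigeonhole: the values up to \<open>i\<close> occupy \<open>i\<close> distinct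
  positions, all between 1 and the running maximum.\<close>

lemma btm_entry_bounds:
  assumes "\<pi> permutes {1..N}" "i \<in> {1..N}"
  shows "i \<le> btm_entry \<pi> i" "btm_entry \<pi> i \<le> N"
proof -
  have inv: "inv \<pi> permutes {1..N}" using assms by (simp add: permutes_inv)
  have "inv \<pi> ` {1..i} \<subseteq> {1..btm_entry \<pi> i}"
    using assms inv_le_btm_entry permutes_in_image[OF inv] by fastforce
  hence "card (inv \<pi> ` {1..i}) \<le> card {1..btm_entry \<pi> i}" by (intro card_mono) auto
  thus "i \<le> btm_entry \<pi> i"
    using card_image[OF inj_on_subset[OF permutes_inj[OF inv], of "{1..i}"]] by simp
  obtain k where "1 \<le> k" "k \<le> i" "btm_entry \<pi> i = inv \<pi> k"
    using assms btm_entry_obtain[of i \<pi>] by auto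
  thus "btm_entry \<pi> i \<le> N" using permutes_in_image[OF inv, of k] assms by auto
qed

text \<open>Justifies the definite description in \<open>btm_path\<close>. The running maxima form a
  sorted word above themselves, hence come from a Dyck path; uniqueness is the injectivity of
  \<open>east_heights\<close>.\<close>

lemma column_height_btm_path:
  assumes "\<pi> permutes {1..N}" "i \<in> {1..N}"
  shows "column_height (btm_path N \<pi>) i = btm_entry \<pi> i"
proof -
  define s where "s = map (btm_entry \<pi>) [1..<Suc N]"
  have nth: "s ! i = btm_entry \<pi> (Suc i)" if "i < N" for i
    using that by (simp add: s_def del: upt_Suc)
  have len: "length s = N" by (simp add: s_def)
  have "sorted s" unfolding sorted_iff_nth_mono using btm_entry_mono by (auto simp: nth len simp del: btm_entry.simps)
  hence "s \<in> sorted_words N (btm_entry \<pi>)"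
    using btm_entry_bounds[OF assms(1)] by (auto simp: sorted_words_def nth len simp del: btm_entry.simps)
  then obtain p where p: "dyck_path N p" "east_heights 0 p = s"
    using bij_betw_imp_surj_on[OF bij_betw_dyck_path_sorted_words[of N "btm_entry \<pi>"]]
      btm_entry_bounds(1)[OF assms(1)] by (metis (no_types, lifting) imageE mem_Collect_eq)
  have col: "column_height p i = btm_entry \<pi> i" if "i \<in> {1..N}" for i
    using that nth[of "i - 1"] by (auto simp: column_height_def p)
  have "\<exists>!p. dyck_path N p \<and> (\<forall>i\<in>{1..N}. column_height p i = btm_entry \<pi> i)"
  proof (rule ex1I[of _ p])
    fix q assume q: "dyck_path N q \<and> (\<forall>i\<in>{1..N}. column_height q i = btm_entry \<pi> i)"
    have "east_heights 0 q = s"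
    proof (rule nth_equalityI)
      show "length (east_heights 0 q) = length s"
        using q by (simp add: length_east_heights dyck_path_iff len)
      fix i assume "i < length (east_heights 0 q)"
      hence "i < N" using q by (simp add: length_east_heights dyck_path_iff)
      moreover have "column_height q (Suc i) = btm_entry \<pi> (Suc i)" using q \<open>i < N\<close> by auto
      ultimately show "east_heights 0 q ! i = s ! i" by (simp add: nth column_height_def)
    qed
    with p q show "q = p" using east_heights_inject[of 0 q p] by (auto simp: dyck_path_iff)
  qed (use p col in auto)
  from theI'[OF this] assms(2) show ?thesis unfolding btm_path_def by blast
qed

text \<open>Taking heights turns the paths into sorted words; \<open>sum_words_above\<close> then
  trades the factorials of the multiplicities for a sum over all words.\<close>

lemma sum_dyck_paths:
  fixes x :: "nat \<Rightarrow> real"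
  assumes "\<pi> permutes {1..N}"
  shows "(\<Sum>p\<in>{p. dyck_path N p \<and> weakly_above N p (btm_path N \<pi>)}.
      (\<Prod>i=1..N. x (column_height p i)) / (\<Prod>j=1..N. fact (steps_at_height p j))) =
    (\<Sum>w\<in>words_above N (btm_entry \<pi>). prod_list (map x w)) / fact N"
proof -
  have m: "\<forall>i\<in>{1..N}. i \<le> btm_entry \<pi> i" using btm_entry_bounds(1)[OF assms] by blast
  have "{p. dyck_path N p \<and> weakly_above N p (btm_path N \<pi>)} =
      {p. dyck_path N p \<and> (\<forall>i\<in>{1..N}. btm_entry \<pi> i \<le> column_height p i)}"
    using column_height_btm_path[OF assms] by (auto simp: weakly_above_def)
  moreover have "(\<Sum>p\<in>{p. dyck_path N p \<and> (\<forall>i\<in>{1..N}. btm_entry \<pi> i \<le> column_height p i)}.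
      (\<Prod>i=1..N. x (column_height p i)) / (\<Prod>j=1..N. fact (steps_at_height p j))) =
    (\<Sum>s\<in>sorted_words N (btm_entry \<pi>). prod_list (map x s) / (\<Prod>j=1..N. fact (count_list s j)))"
    by (subst sum.reindex_bij_betw[OF bij_betw_dyck_path_sorted_words[OF m], symmetric])
       (auto simp: prod_column_height[unfolded One_nat_def] steps_at_height_def intro!: sum.cong)
  ultimately show ?thesis by (simp add: sum_words_above[OF m])
qed

lemma sum_dominating_words:
  fixes x :: "nat \<Rightarrow> real"
  assumes "\<pi> permutes {1..N}"
  shows "(\<Sum>w\<in>{w. dominates N w (btm_word N \<pi>)}. \<Prod>i<N. x (nat (w ! i))) =
    (\<Sum>w\<in>words_above N (btm_entry \<pi>). prod_list (map x w))"
proof -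
  have m: "\<forall>i\<in>{1..N}. i \<le> btm_entry \<pi> i" using btm_entry_bounds(1)[OF assms] by blast
  have "(\<Sum>w\<in>{w. dominates N w (btm_word N \<pi>)}. \<Prod>i<N. x (nat (w ! i))) =
      (\<Sum>w\<in>words_above N (btm_entry \<pi>). \<Prod>i<N. x (nat (map int w ! i)))"
    unfolding btm_word_def
    using sum.reindex_bij_betw[OF bij_betw_words_above_dominates[OF m], symmetric] .
  also have "\<dots> = (\<Sum>w\<in>words_above N (btm_entry \<pi>). prod_list (map x w))"
  proof (rule sum.cong[OF refl])
    fix w assume "w \<in> words_above N (btm_entry \<pi>)"
    hence "length w = N" by (auto simp: words_above_def sorted_words_def)
    thus "(\<Prod>i<N. x (nat (map int w ! i))) = prod_list (map x w)"
      by (auto simp: prod_nth_eq_prod_list[symmetric] intro!: prod.cong)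
  qed
  finally show ?thesis .
qed

section \<open>Uniform points of the unit cube\<close>

text \<open>Conditioning a product measure on a box conditions the factors independently: on a box
  \<open>Pi\<^sub>E I B\<close> both measures are the product of the quotients of the measures of
  \<open>A i \<inter> B i\<close> and \<open>A i\<close>, and boxes determine a product
  measure.\<close>

lemma PiM_uniform_measure:
  assumes "finite I" and M: "\<And>i. prob_space (M i)"
    and A: "\<And>i. i \<in> I \<Longrightarrow> A i \<in> sets (M i)" "\<And>i. i \<in> I \<Longrightarrow> 0 < measure (M i) (A i)"
  shows "PiM I (\<lambda>i. uniform_measure (M i) (A i)) = uniform_measure (PiM I M) (Pi\<^sub>E I A)"
proof -
  interpret M: product_prob_space M I
    by (intro product_prob_space.intro product_prob_space_axioms.intro product_sigma_finite.intro M
        prob_space_imp_sigma_finite)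
  \<comment> \<open>Nothing is known about \<open>A i\<close> outside \<open>I\<close>, but
    \<open>product_sigma_finite\<close> asks for sigma-finiteness at every index; so the original
    measure is kept there.\<close>
  define U where "U i = (if i \<in> I then uniform_measure (M i) (A i) else M i)" for i
  have em: "emeasure (M i) (A i) \<noteq> 0" if "i \<in> I" for i
    using A(2)[OF that] by (simp add: M.M.emeasure_eq_measure)
  interpret U: product_sigma_finite U
  proof
    fix i show "\<exists>A. countable A \<and> A \<subseteq> sets (U i) \<and> \<Union> A = space (U i) \<and> (\<forall>a\<in>A. emeasure (U i) a \<noteq> \<infinity>)"
    proof (rule sigma_finite_measure.sigma_finite_countable, rule prob_space_imp_sigma_finite)
      show "prob_space (U i)"
        using em[of i] by (auto simp: U_def M M.M.emeasure_eq_measure intro!: prob_space_uniform_measure)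
    qed
  qed
  have "uniform_measure (PiM I M) (Pi\<^sub>E I A) = PiM I U"
  proof (rule U.PiM_eqI)
    show "sets (uniform_measure (PiM I M) (Pi\<^sub>E I A)) = sets (PiM I U)"
      unfolding sets_uniform_measure by (rule sets_PiM_cong) (auto simp: U_def)
    fix B assume "\<And>i. i \<in> I \<Longrightarrow> B i \<in> sets (U i)"
    hence B: "B i \<in> sets (M i)" if "i \<in> I" for i using that by (auto simp: U_def)
    have "emeasure (uniform_measure (PiM I M) (Pi\<^sub>E I A)) (Pi\<^sub>E I B) =
        emeasure (PiM I M) (\<Pi>\<^sub>E i\<in>I. A i \<inter> B i) / emeasure (PiM I M) (Pi\<^sub>E I A)"
      by (subst emeasure_uniform_measure) (auto simp: PiE_Int A B \<open>finite I\<close> intro!: sets_PiM_I_finite)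
    also have "\<dots> = (\<Prod>i\<in>I. ennreal (measure (M i) (A i \<inter> B i))) / (\<Prod>i\<in>I. ennreal (measure (M i) (A i)))"
      using M.emeasure_PiM[of I A] M.emeasure_PiM[of I "\<lambda>i. A i \<inter> B i"]
      by (simp add: A B sets.Int \<open>finite I\<close> M.M.emeasure_eq_measure)
    also have "\<dots> = (\<Prod>i\<in>I. ennreal (measure (M i) (A i \<inter> B i) / measure (M i) (A i)))"
      using A(2) by (simp add: prod_ennreal divide_ennreal prod_nonneg prod_pos prod_dividef)
    also have "\<dots> = (\<Prod>i\<in>I. emeasure (U i) (B i))"
      using A B by (intro prod.cong) (auto simp: U_def M.M.emeasure_eq_measure divide_ennreal)
    finally show "emeasure (uniform_measure (PiM I M) (Pi\<^sub>E I A)) (Pi\<^sub>E I B) =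
        (\<Prod>i\<in>I. emeasure (U i) (B i))" .
  qed fact
  moreover have "PiM I U = PiM I (\<lambda>i. uniform_measure (M i) (A i))"
    by (rule PiM_cong) (auto simp: U_def)
  ultimately show ?thesis by simp
qed

section \<open>The uniform measure on the unit cube\<close>

abbreviation unit_uniform :: "real measure" where
  "unit_uniform \<equiv> uniform_measure lborel {0..1}"

definition cube :: "nat \<Rightarrow> (nat \<Rightarrow> real) measure" where
  "cube N = (\<Pi>\<^sub>M i\<in>{1..N}. unit_uniform)"

interpretation unit_uniform: prob_space unit_uniform
  by (rule prob_space_uniform_measure) auto

interpretation unit_uniforms: product_prob_space "\<lambda>_::nat. unit_uniform" "{1..N}" for N
  by (intro product_prob_space.intro product_prob_space_axioms.intro product_sigma_finite.intro
      unit_uniform.prob_space_axioms unit_uniform.sigma_finite_measure_axioms)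

interpretation cube: prob_space "cube N" for N
  unfolding cube_def by (intro prob_space_PiM unit_uniform.prob_space_axioms)

lemma measurable_cube_component [measurable (raw)]:
  "i \<in> {1..N} \<Longrightarrow> (\<lambda>y. y i) \<in> borel_measurable (cube N)"
proof -
  assume "i \<in> {1..N}"
  hence "(\<lambda>y. y i) \<in> measurable (cube N) unit_uniform"
    unfolding cube_def by (rule measurable_component_singleton)
  thus ?thesis by (simp cong: measurable_cong_sets)
qed

lemma measure_unit_uniform_atLeastLessThan:
  "0 \<le> a \<Longrightarrow> a \<le> b \<Longrightarrow> b \<le> 1 \<Longrightarrow> measure unit_uniform {a..<b} = b - a"
proof -
  assume "0 \<le> a" "a \<le> b" "b \<le> 1"
  hence "{0..1} \<inter> {a..<b} = {a..<b}" by auto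
  with \<open>a \<le> b\<close> show ?thesis by simp
qed

lemma measure_unit_uniform_atLeast:
  "0 \<le> a \<Longrightarrow> a \<le> 1 \<Longrightarrow> measure unit_uniform {a..} = 1 - a"
proof -
  assume "0 \<le> a" "a \<le> 1"
  hence "{0..1} \<inter> {a..} = {a..1}" by auto
  with \<open>a \<le> 1\<close> show ?thesis by simp
qed

text \<open>Identifies each selection of the experiment with a conditioned coordinate of the cube;
  the upper end 1 is already imposed by \<open>unit_uniform\<close>.\<close>

lemma uniform_measure_unit_uniform_atLeast:
  assumes "0 \<le> a" "a < 1"
  shows "uniform_measure unit_uniform {a..} = uniform_measure lborel {a..1}"
proof (rule measure_eqI)
  fix B assume "B \<in> sets (uniform_measure unit_uniform {a..})"
  hence B: "B \<in> sets borel" by simp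
  have eq: "{0..1} \<inter> {a..} = {a..1}" "{0..1} \<inter> ({a..} \<inter> B) = {a..1} \<inter> B" using assms by auto
  show "emeasure (uniform_measure unit_uniform {a..}) B = emeasure (uniform_measure lborel {a..1}) B"
    using B assms by (simp add: eq divide_ennreal_def max_absorb2)
qed simp

lemma measure_cube_PiE:
  assumes "\<And>i. i \<in> {1..N} \<Longrightarrow> A i \<in> sets borel"
  shows "measure (cube N) (Pi\<^sub>E {1..N} A) = (\<Prod>i=1..N. measure unit_uniform (A i))"
proof -
  interpret finite_product_prob_space "\<lambda>_::nat. unit_uniform" "{1..N}" by unfold_locales auto
  show ?thesis unfolding cube_def using assms by (intro prob_times) auto
qed

text \<open>The endpoint 1 is excluded because it belongs to none of the half-open cells used
  later.\<close>

lemma AE_cube_component: "AE y in cube N. \<forall>i\<in>{1..N}. 0 \<le> y i \<and> y i < 1"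
proof (rule AE_finite_allI)
  fix i assume i: "i \<in> {1..N}"
  have "AE t in unit_uniform. 0 \<le> t \<and> t < 1"
    by (rule AE_uniform_measureI) (auto intro: AE_mp[OF AE_lborel_singleton[of 1]])
  thus "AE y in cube N. 0 \<le> y i \<and> y i < 1"
    unfolding cube_def by (intro AE_PiM_component unit_uniform.prob_space_axioms i)
qed simp

text \<open>Integrate over coordinate \<open>i\<close> first: with the others fixed,
  \<open>y i\<close> would have to hit the single point \<open>y j\<close>, a null set.\<close>

lemma AE_cube_neq:
  assumes "i \<in> {1..N}" "j \<in> {1..N}" "i \<noteq> j"
  shows "AE y in cube N. y i \<noteq> y j"
proof -
  define I where "I = {1..N} - {i}"
  have I: "insert i I = {1..N}" "i \<notin> I" "finite I" using assms by (auto simp: I_def)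
  define D where "D = {y \<in> space (cube N). y i = y j}"
  have D: "D \<in> sets (cube N)" using assms unfolding D_def by measurable
  have "emeasure (cube N) D =
      (\<integral>\<^sup>+ y. indicator D y \<partial>cube N)"
    using D by simp
  also have "\<dots> = (\<integral>\<^sup>+ y. (\<integral>\<^sup>+ t. indicator D (y(i := t))
      \<partial>unit_uniform) \<partial>(\<Pi>\<^sub>M i\<in>I. unit_uniform))"
    unfolding cube_def I(1)[symmetric]
    by (rule unit_uniforms.product_nn_integral_insert[OF I(3,2)])
      (use D in \<open>simp add: I(1) cube_def\<close>)
  also have "\<dots> \<le> (\<integral>\<^sup>+ y. (\<integral>\<^sup>+ t. indicator {y j} t
      \<partial>unit_uniform) \<partial>(\<Pi>\<^sub>M i\<in>I. unit_uniform))"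
    using assms by (intro nn_integral_mono) (auto simp: D_def split: split_indicator)
  also have "\<dots> = 0"
  proof -
    have "{0..1} \<inter> {t} = {} \<or> {0..1} \<inter> {t} = {t}" for t :: real by auto
    hence "emeasure unit_uniform {t} = 0" for t by (auto, metis emeasure_empty emeasure_lborel_singleton)
    thus ?thesis by simp
  qed
  finally show ?thesis
    using D by (intro AE_I[of _ _ D]) (auto simp: D_def)
qed

lemma AE_cube_inj_on: "AE y in cube N. inj_on y {1..N}"
proof -
  have "AE y in cube N. \<forall>i\<in>{1..N}. \<forall>j\<in>{1..N}. i \<noteq> j \<longrightarrow> y i \<noteq> y j"
    by (intro AE_finite_allI AE_impI AE_cube_neq) auto
  thus ?thesis by (rule AE_mp) (auto simp: inj_on_def)
qed

text \<open>\<open>\<sigma> j\<close> is the position of the \<open>j\<close>-th smallest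
  coordinate, so an ordering \<open>\<pi>\<close> enters as \<open>inv \<pi>\<close>. The bound
  \<open>c j\<close> is attached to the rank and not to the position, which makes the volume
  independent of \<open>\<sigma>\<close>.\<close>

definition ordered_above :: "nat \<Rightarrow> (nat \<Rightarrow> real) \<Rightarrow> (nat \<Rightarrow> nat) \<Rightarrow> (nat \<Rightarrow> real) set" where
  "ordered_above N c \<sigma> = {y \<in> space (cube N).
     (\<forall>j\<in>{1..N}. \<forall>k\<in>{1..N}. j < k \<longrightarrow> y (\<sigma> j) < y (\<sigma> k)) \<and> (\<forall>j\<in>{1..N}. c j \<le> y (\<sigma> j))}"

lemma sets_ordered_above:
  assumes "\<sigma> permutes {1..N}"
  shows "ordered_above N c \<sigma> \<in> sets (cube N)"
proof -
  have [measurable]: "(\<lambda>y. y (\<sigma> j)) \<in> borel_measurable (cube N)" if "j \<in> {1..N}" for j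
    using that permutes_in_image[OF assms] by (intro measurable_cube_component) auto
  show ?thesis unfolding ordered_above_def by measurable
qed

text \<open>Permuting coordinates preserves the cube measure, and the map \<open>?t\<close> pulls
  the region of the identity back to that of \<open>\<sigma>\<close>.\<close>

lemma measure_ordered_above:
  assumes \<sigma>: "\<sigma> permutes {1..N}"
  shows "measure (cube N) (ordered_above N c \<sigma>) = measure (cube N) (ordered_above N c id)"
proof -
  let ?t = "\<lambda>y. \<lambda>i\<in>{1..N}. y (\<sigma> i)"
  have in_image: "\<sigma> i \<in> {1..N}" if "i \<in> {1..N}" for i
    using that permutes_in_image[OF \<sigma>] by simp
  have distr: "distr (cube N) (cube N) ?t = cube N"
    unfolding cube_def
    using distr_PiM_reindex[of "{1..N}" "\<lambda>_. unit_uniform" \<sigma> "{1..N}"] in_image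
    by (auto simp: unit_uniform.prob_space_axioms permutes_inj_on[OF \<sigma>])
  have meas: "?t \<in> measurable (cube N) (cube N)"
    unfolding cube_def
    by (intro measurable_restrict measurable_component_singleton in_image)
  have "measure (cube N) (ordered_above N c id) =
      measure (cube N) (?t -` ordered_above N c id \<inter> space (cube N))"
    by (subst distr[symmetric], rule measure_distr[OF meas]) (rule sets_ordered_above[OF permutes_id])
  also have "?t -` ordered_above N c id \<inter> space (cube N) = ordered_above N c \<sigma>"
    using measurable_space[OF meas] by (auto simp: ordered_above_def)
  finally show ?thesis ..
qed

section \<open>Relative orderings\<close>

text \<open>If the heights increase along \<open>inv \<rho>\<close>, the coordinates at most
  \<open>y i\<close> sit exactly at the positions of the values \<open>1\<close> to
  \<open>\<rho> i\<close>. The inequalities also make the event visibly measurable.\<close>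

lemma rank_of_eq_iff:
  assumes "\<rho> permutes {1..N}"
  shows "(\<forall>i\<in>{1..N}. rank_of N y i = \<rho> i) \<longleftrightarrow>
    (\<forall>j\<in>{1..N}. \<forall>k\<in>{1..N}. j < k \<longrightarrow> y (inv \<rho> j) < y (inv \<rho> k))"
    (is "?rank \<longleftrightarrow> ?ordered")
proof
  have inv: "inv \<rho> permutes {1..N}" using assms by (rule permutes_inv)
  assume rank: ?rank
  show ?ordered
  proof (intro ballI impI, rule ccontr)
    fix j k assume jk: "j \<in> {1..N}" "k \<in> {1..N}" "j < k" "\<not> y (inv \<rho> j) < y (inv \<rho> k)"
    hence "rank_of N y (inv \<rho> k) \<le> rank_of N y (inv \<rho> j)"
      unfolding rank_of_def by (intro card_mono) auto
    moreover have "inv \<rho> j \<in> {1..N}" "inv \<rho> k \<in> {1..N}"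
      using jk permutes_in_image[OF inv] by blast+
    ultimately have "k \<le> j" using rank permutes_inverses(1)[OF assms] by metis
    with jk show False by simp
  qed
next
  have inv: "inv \<rho> permutes {1..N}" using assms by (rule permutes_inv)
  assume ordered: ?ordered
  show ?rank
  proof
    fix i assume i: "i \<in> {1..N}"
    hence \<rho>i: "\<rho> i \<in> {1..N}" using permutes_in_image[OF assms] by blast
    have less_iff: "y (inv \<rho> k) \<le> y i \<longleftrightarrow> k \<le> \<rho> i" if k: "k \<in> {1..N}" for k
    proof (cases k "\<rho> i" rule: linorder_cases)
      case less
      with ordered k \<rho>i have "y (inv \<rho> k) < y (inv \<rho> (\<rho> i))" by blast
      with less show ?thesis by (simp add: permutes_inverses(2)[OF assms])
    next
      case equal
      thus ?thesis by (simp add: permutes_inverses(2)[OF assms])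
    next
      case greater
      with ordered k \<rho>i have "y (inv \<rho> (\<rho> i)) < y (inv \<rho> k)" by blast
      with greater show ?thesis by (simp add: permutes_inverses(2)[OF assms])
    qed
    have "{j \<in> {1..N}. y j \<le> y i} = inv \<rho> ` {1..\<rho> i}"
    proof (intro equalityI subsetI)
      fix j assume j: "j \<in> {j \<in> {1..N}. y j \<le> y i}"
      hence "\<rho> j \<in> {1..N}" using permutes_in_image[OF assms] by blast
      with j less_iff[of "\<rho> j"] have "\<rho> j \<in> {1..\<rho> i}" by (simp add: permutes_inverses(2)[OF assms])
      thus "j \<in> inv \<rho> ` {1..\<rho> i}" by (metis imageI permutes_inverses(2)[OF assms])
    next
      fix j assume "j \<in> inv \<rho> ` {1..\<rho> i}"
      then obtain k where k: "k \<in> {1..\<rho> i}" "j = inv \<rho> k" by blast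
      with \<rho>i have "k \<in> {1..N}" by auto
      with k less_iff[of k] permutes_in_image[OF inv, of k] show "j \<in> {j \<in> {1..N}. y j \<le> y i}" by auto
    qed
    thus "rank_of N y i = \<rho> i"
      using card_image[OF inj_on_subset[OF permutes_inj[OF inv] subset_UNIV]] by (simp add: rank_of_def)
  qed
qed

text \<open>Distinct heights have distinct ranks between 1 and \<open>N\<close>. The identity
  outside the range is what \<open>permutes\<close> demands.\<close>

lemma rank_of_permutes:
  assumes "inj_on y {1..N}"
  shows "(\<lambda>i. if i \<in> {1..N} then rank_of N y i else i) permutes {1..N}"
proof (rule bij_imp_permutes)
  have less: "rank_of N y i < rank_of N y j" if "j \<in> {1..N}" "y i < y j" for i j
  proof -
    have "{k \<in> {1..N}. y k \<le> y i} \<subseteq> {k \<in> {1..N}. y k \<le> y j}"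
      and "j \<in> {k \<in> {1..N}. y k \<le> y j}" "j \<notin> {k \<in> {1..N}. y k \<le> y i}"
      using that by auto
    hence "{k \<in> {1..N}. y k \<le> y i} \<subset> {k \<in> {1..N}. y k \<le> y j}" by blast
    thus ?thesis unfolding rank_of_def by (intro psubset_card_mono) auto
  qed
  have "inj_on (rank_of N y) {1..N}"
  proof (rule inj_onI, rule ccontr)
    fix i j assume ij: "i \<in> {1..N}" "j \<in> {1..N}" "rank_of N y i = rank_of N y j" "i \<noteq> j"
    with assms have "y i \<noteq> y j" by (auto dest: inj_onD)
    with less[of i j] less[of j i] ij show False by (cases "y i < y j") auto
  qed
  moreover have "rank_of N y ` {1..N} \<subseteq> {1..N}"
  proof
    fix r assume "r \<in> rank_of N y ` {1..N}"
    then obtain i where i: "i \<in> {1..N}" "r = rank_of N y i" by blast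
    have "rank_of N y i \<le> card {1..N}" unfolding rank_of_def by (intro card_mono) auto
    moreover have "rank_of N y i > 0" unfolding rank_of_def using i by (auto simp: card_gt_0_iff)
    ultimately show "r \<in> {1..N}" using i by auto
  qed
  ultimately have "bij_betw (rank_of N y) {1..N} {1..N}"
    by (simp add: bij_betw_def endo_inj_surj)
  thus "bij_betw (\<lambda>i. if i \<in> {1..N} then rank_of N y i else i) {1..N} {1..N}"
    by (rule bij_betw_cong[THEN iffD1, rotated]) simp
qed auto

section \<open>The reselect experiment\<close>

locale reselect =
  fixes N :: nat and x :: "nat \<Rightarrow> real"
  assumes N_pos: "1 \<le> N"
    and x_nonneg: "i \<in> {1..N} \<Longrightarrow> 0 \<le> x i"
    and x_last: "0 < x N"
    and x_total: "(\<Sum>i=1..N. x i) = 1"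
begin

text \<open>By \<open>x_total\<close> this is the partial sum called \<open>b i\<close> above; as
  written it is the left endpoint of the \<open>i\<close>-th interval of the experiment.\<close>

definition left_end :: "nat \<Rightarrow> real" where
  "left_end i = 1 - tail_sum N x i"

text \<open>Half-open, so that the cells for \<open>1\<close> to \<open>N\<close> are disjoint and
  cover the points from 0 up to but excluding 1; the cell is empty when
  \<open>x k = 0\<close>.\<close>

definition cell :: "nat \<Rightarrow> real set" where
  "cell k = {left_end k..<left_end (Suc k)}"

lemma left_end_1: "left_end 1 = 0"
  by (simp add: left_end_def tail_sum_def x_total del: One_nat_def)

lemma left_end_Suc_N: "left_end (Suc N) = 1"
  by (simp add: left_end_def tail_sum_def)

lemma left_end_Suc: "i \<le> N \<Longrightarrow> left_end (Suc i) = left_end i + x i"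
  by (simp add: left_end_def tail_sum_def sum.atLeast_Suc_atMost)

lemma left_end_mono:
  assumes "1 \<le> i" "i \<le> j"
  shows "left_end i \<le> left_end j"
proof -
  have "tail_sum N x j \<le> tail_sum N x i"
    unfolding tail_sum_def using assms x_nonneg by (intro sum_mono2) auto
  thus ?thesis by (simp add: left_end_def)
qed

lemma tail_sum_pos:
  assumes "i \<in> {1..N}"
  shows "0 < tail_sum N x i"
proof -
  have "left_end i \<le> left_end N" using assms by (intro left_end_mono) auto
  with x_last show ?thesis by (simp add: left_end_def tail_sum_def)
qed

lemma left_end_bounds:
  assumes "i \<in> {1..N}"
  shows "0 \<le> left_end i" "left_end i < 1"
  using left_end_mono[of 1 i] assms tail_sum_pos[of i] left_end_1 by (auto simp: left_end_def)

lemma measure_cell: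
  assumes "k \<in> {1..N}"
  shows "measure unit_uniform (cell k) = x k"
  unfolding cell_def
  using assms left_end_bounds[of k] left_end_mono[of k "Suc k"] left_end_mono[of "Suc k" "Suc N"]
  by (subst measure_unit_uniform_atLeastLessThan) (auto simp: left_end_Suc_N left_end_Suc)

text \<open>The bridge from geometry to words: by monotonicity of the left ends, a threshold at a
  cut point only depends on the cell containing \<open>t\<close>.\<close>

lemma left_end_le_iff:
  assumes "k \<in> {1..N}" "t \<in> cell k" "1 \<le> j"
  shows "left_end j \<le> t \<longleftrightarrow> j \<le> k"
proof
  assume "left_end j \<le> t"
  show "j \<le> k"
  proof (rule ccontr)
    assume "\<not> j \<le> k"
    hence "left_end (Suc k) \<le> left_end j" by (intro left_end_mono) auto
    with assms \<open>left_end j \<le> t\<close> show False by (auto simp: cell_def)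
  qed
next
  assume "j \<le> k"
  thus "left_end j \<le> t" using left_end_mono[of j k] assms by (auto simp: cell_def)
qed

text \<open>Take the last cut point not exceeding \<open>t\<close>. The next one is larger by
  maximality, or because it equals 1 when \<open>k = N\<close>.\<close>

lemma ex_cell:
  assumes "0 \<le> t" "t < 1"
  shows "\<exists>k\<in>{1..N}. t \<in> cell k"
proof -
  define K where "K = {k \<in> {1..N}. left_end k \<le> t}"
  have "1 \<in> K" using assms left_end_1 N_pos by (auto simp: K_def)
  have "finite K" by (auto simp: K_def)
  define k where "k = Max K"
  have k: "k \<in> K" unfolding k_def using \<open>finite K\<close> \<open>1 \<in> K\<close> by (intro Max_in) auto
  have "Suc k \<notin> K" using Max_ge[OF \<open>finite K\<close>, of "Suc k"] by (auto simp: k_def)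
  hence "t < left_end (Suc k)"
    using k assms left_end_Suc_N by (cases "k = N") (auto simp: K_def)
  with k show ?thesis by (auto simp: K_def cell_def)
qed

definition cell_index :: "real \<Rightarrow> nat" where
  "cell_index t = (SOME k. k \<in> {1..N} \<and> t \<in> cell k)"

lemma cell_index:
  assumes "0 \<le> t" "t < 1"
  shows "cell_index t \<in> {1..N}" "t \<in> cell (cell_index t)"
  using someI_ex[of "\<lambda>k. k \<in> {1..N} \<and> t \<in> cell k"] ex_cell[OF assms]
  unfolding cell_index_def by blast+

lemma cell_index_unique:
  assumes "k \<in> {1..N}" "t \<in> cell k" "0 \<le> t" "t < 1"
  shows "cell_index t = k"
proof -
  note c = cell_index[OF assms(3,4)]
  have "cell_index t \<le> k" using left_end_le_iff[OF assms(1,2), of "cell_index t"] c by (auto simp: cell_def)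
  moreover have "k \<le> cell_index t" using left_end_le_iff[OF c, of k] assms by (auto simp: cell_def)
  ultimately show ?thesis by simp
qed

section \<open>Words as boxes in the cube\<close>

definition word_box :: "nat list \<Rightarrow> (nat \<Rightarrow> real) set" where
  "word_box w = (\<Pi>\<^sub>E i\<in>{1..N}. cell (w ! (i - 1)))"

lemma measure_word_box:
  assumes "set w \<subseteq> {1..N}" "length w = N"
  shows "measure (cube N) (word_box w) = prod_list (map x w)"
proof -
  have "measure (cube N) (word_box w) = (\<Prod>i=1..N. measure unit_uniform (cell (w ! (i - 1))))"
    unfolding word_box_def by (intro measure_cube_PiE) (auto simp: cell_def)
  also have "\<dots> = (\<Prod>i=1..N. x (w ! (i - 1)))"
    using assms by (intro prod.cong measure_cell) (auto simp: subset_iff)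
  also have "\<dots> = (\<Prod>i<length w. x (w ! i))"
    using assms by (simp add: prod.atLeast1_atMost_eq)
  finally show ?thesis by (simp only: prod_nth_eq_prod_list)
qed

text \<open>Such a point is sorted by exactly one permutation and lies in exactly one box.\<close>

lemma sum_ordered_above_eq_sum_word_box:
  assumes m: "\<And>i. i \<in> {1..N} \<Longrightarrow> i \<le> m i" "\<And>i. i \<in> {1..N} \<Longrightarrow> m i \<le> N"
    and y: "y \<in> space (cube N)" "inj_on y {1..N}" "\<forall>i\<in>{1..N}. 0 \<le> y i \<and> y i < 1"
  shows "(\<Sum>\<rho> | \<rho> permutes {1..N}. indicator (ordered_above N (left_end \<circ> m) (inv \<rho>)) y :: real) =
    (\<Sum>w\<in>words_above N m. indicator (word_box w) y)"
proof -
  \<comment> \<open>The ordering of \<open>y\<close> itself, the only one that can contribute to the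
    left-hand sum.\<close>
  define \<rho>' where "\<rho>' = (\<lambda>i. if i \<in> {1..N} then rank_of N y i else i)"
  have \<rho>': "\<rho>' permutes {1..N}" unfolding \<rho>'_def by (rule rank_of_permutes) fact
  define \<sigma> where "\<sigma> = inv \<rho>'"
  have \<sigma>: "\<sigma> permutes {1..N}" using \<rho>' by (simp add: \<sigma>_def permutes_inv)
  have \<sigma>_in: "\<sigma> i \<in> {1..N}" if "i \<in> {1..N}" for i using that permutes_in_image[OF \<sigma>] by blast
  have ordered: "\<forall>j\<in>{1..N}. \<forall>k\<in>{1..N}. j < k \<longrightarrow> y (\<sigma> j) < y (\<sigma> k)"
    using rank_of_eq_iff[OF \<rho>', of y] by (simp add: \<rho>'_def \<sigma>_def)
  have unique: "\<rho> = \<rho>'" if "\<rho> permutes {1..N}" "\<forall>i\<in>{1..N}. rank_of N y i = \<rho> i" for \<rho>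
    using that \<rho>' by (auto simp: \<rho>'_def fun_eq_iff permutes_not_in)
  \<comment> \<open>The word of cells of \<open>y\<close>, the only word whose box contains
    \<open>y\<close>.\<close>
  define w0 where "w0 = map (cell_index \<circ> y) [1..<Suc N]"
  have w0_nth: "w0 ! i = cell_index (y (Suc i))" if "i < N" for i
    using that by (simp add: w0_def del: upt_Suc)
  have len0: "length w0 = N" by (simp add: w0_def)

  have "mset (map \<sigma> [1..<Suc N]) = mset [1..<Suc N]"
  proof -
    have "mset (map \<sigma> [1..<Suc N]) = image_mset \<sigma> (mset_set {1..<Suc N})"
      by (simp del: upt_Suc)
    also have "\<dots> = mset_set (\<sigma> ` {1..<Suc N})"
      by (rule image_mset_mset_set) (rule permutes_inj_on[OF \<sigma>])
    also have "\<sigma> ` {1..<Suc N} = {1..<Suc N}"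
      using permutes_image[OF \<sigma>] by (simp add: atLeastLessThanSuc_atLeastAtMost)
    finally show ?thesis by (simp del: upt_Suc)
  qed
  hence "mset (map (cell_index \<circ> y) (map \<sigma> [1..<Suc N])) = mset w0"
    unfolding w0_def by (metis mset_map)
  moreover have "sorted (map (cell_index \<circ> y) (map \<sigma> [1..<Suc N]))"
  proof -
    have "cell_index (y (\<sigma> j)) \<le> cell_index (y (\<sigma> k))" if jk: "j \<in> {1..N}" "k \<in> {1..N}" "j \<le> k" for j k
    proof -
      have le: "y (\<sigma> j) \<le> y (\<sigma> k)" using ordered jk by (cases "j = k") (auto intro: less_imp_le)
      have c: "cell_index (y (\<sigma> i)) \<in> {1..N} \<and> y (\<sigma> i) \<in> cell (cell_index (y (\<sigma> i)))"
        if "i \<in> {1..N}" for i using y(3) \<sigma>_in[OF that] cell_index by blast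
      have "left_end (cell_index (y (\<sigma> j))) \<le> y (\<sigma> k)"
        using c[OF jk(1)] le by (auto simp: cell_def)
      with left_end_le_iff[of "cell_index (y (\<sigma> k))"] c[OF jk(1)] c[OF jk(2)] show ?thesis by auto
    qed
    thus ?thesis by (auto simp: sorted_iff_nth_mono simp del: upt_Suc)
  qed
  \<comment> \<open>The cell number is monotone in the height, so listing the cells by increasing
    height along \<open>\<sigma>\<close> sorts the word.\<close>
  ultimately have "sort w0 = map (cell_index \<circ> y) (map \<sigma> [1..<Suc N])"
    by (rule properties_for_sort)
  hence sort: "sort w0 = map (\<lambda>j. cell_index (y (\<sigma> j))) [1..<Suc N]"
    by (simp add: comp_def del: upt_Suc)
  have sort_nth: "sort w0 ! i = cell_index (y (\<sigma> (Suc i)))" if "i < N" for i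
    using that by (simp add: sort del: upt_Suc)
  have c: "cell_index (y (\<sigma> i)) \<in> {1..N} \<and> (left_end (m i) \<le> y (\<sigma> i) \<longleftrightarrow> m i \<le> cell_index (y (\<sigma> i)))"
    if i: "i \<in> {1..N}" for i
  proof -
    have c: "cell_index (y (\<sigma> i)) \<in> {1..N}" "y (\<sigma> i) \<in> cell (cell_index (y (\<sigma> i)))"
      using y(3) \<sigma>_in[OF i] cell_index by blast+
    moreover have "1 \<le> m i" using m(1)[OF i] i by auto
    ultimately show ?thesis using left_end_le_iff by blast
  qed
  have "w0 \<in> words_above N m \<longleftrightarrow> (\<forall>i<N. m (Suc i) \<le> cell_index (y (\<sigma> (Suc i))))"
    using c by (auto simp: words_above_def sorted_words_def len0 sort_nth)
  also have "\<dots> \<longleftrightarrow> (\<forall>i\<in>{1..N}. m i \<le> cell_index (y (\<sigma> i)))"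
    unfolding image_Suc_lessThan[symmetric] by auto
  also have "\<dots> \<longleftrightarrow> y \<in> ordered_above N (left_end \<circ> m) \<sigma>"
    using c y(1) ordered by (auto simp: ordered_above_def)
  finally have iff: "w0 \<in> words_above N m \<longleftrightarrow> y \<in> ordered_above N (left_end \<circ> m) \<sigma>" .

  have "(\<Sum>\<rho> | \<rho> permutes {1..N}. indicator (ordered_above N (left_end \<circ> m) (inv \<rho>)) y :: real) =
      (\<Sum>\<rho> | \<rho> permutes {1..N}. if \<rho> = \<rho>' then indicator (ordered_above N (left_end \<circ> m) \<sigma>) y else 0)"
  proof (rule sum.cong[OF refl])
    fix \<rho> assume "\<rho> \<in> {\<rho>. \<rho> permutes {1..N}}"
    hence \<rho>: "\<rho> permutes {1..N}" by simp
    have "y \<notin> ordered_above N (left_end \<circ> m) (inv \<rho>)" if "\<rho> \<noteq> \<rho>'"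
      using that unique[OF \<rho>] rank_of_eq_iff[OF \<rho>, of y] by (auto simp: ordered_above_def)
    thus "indicator (ordered_above N (left_end \<circ> m) (inv \<rho>)) y =
      (if \<rho> = \<rho>' then indicator (ordered_above N (left_end \<circ> m) \<sigma>) y else (0::real))"
      by (auto simp: \<sigma>_def)
  qed
  also have "\<dots> = indicator (ordered_above N (left_end \<circ> m) \<sigma>) y"
    using \<rho>' by (simp add: finite_permutations)
  \<comment> \<open>Each side has at most one nonzero term, and \<open>iff\<close> says that they
    are present simultaneously.\<close>
  also have "\<dots> = (\<Sum>w\<in>words_above N m. if w = w0 then 1 else 0)"
    using finite_words_above[of N m] m(1) iff by (simp add: indicator_def)
  also have "\<dots> = (\<Sum>w\<in>words_above N m. indicator (word_box w) y)"
  proof (rule sum.cong[OF refl])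
    fix w assume "w \<in> words_above N m"
    hence w: "set w \<subseteq> {1..N}" "length w = N" using words_above_subset[of N m] m(1) by auto
    have "y \<in> word_box w \<longleftrightarrow> w = w0"
    proof
      assume yw: "y \<in> word_box w"
      show "w = w0"
      proof (rule nth_equalityI)
        fix i assume "i < length w"
        hence i: "Suc i \<in> {1..N}" "i < N" using w by auto
        have "y (Suc i) \<in> cell (w ! i)" using yw i by (auto simp: word_box_def dest: PiE_mem[where x = "Suc i"])
        moreover have "w ! i \<in> {1..N}" using nth_mem[of i w] w i by blast
        ultimately show "w ! i = w0 ! i" using cell_index_unique y(3) i w0_nth[OF i(2)] by metis
      qed (simp add: w len0)
    next
      assume "w = w0"
      have "y i \<in> cell (w ! (i - 1))" if i: "i \<in> {1..N}" for i
        using cell_index[of "y i"] y(3) i w0_nth[of "i - 1"] \<open>w = w0\<close> by auto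
      thus "y \<in> word_box w" using y(1) by (auto simp: word_box_def cube_def space_PiM PiE_def)
    qed
    thus "(if w = w0 then 1 else 0) = (indicator (word_box w) y :: real)" by (simp add: indicator_def)
  qed
  finally show ?thesis .
qed

text \<open>By symmetry the \<open>N!\<close> copies may be spread over all orderings. Both sides
  are then integrals of sums of indicators, which agree almost everywhere by the pointwise
  identity.\<close>

lemma measure_ordered_above_eq_sum_words:
  assumes m: "\<And>i. i \<in> {1..N} \<Longrightarrow> i \<le> m i" "\<And>i. i \<in> {1..N} \<Longrightarrow> m i \<le> N"
    and \<sigma>: "\<sigma> permutes {1..N}"
  shows "fact N * measure (cube N) (ordered_above N (left_end \<circ> m) \<sigma>) =
    (\<Sum>w\<in>words_above N m. prod_list (map x w))"
proof -
  let ?E = "\<lambda>\<rho>. ordered_above N (left_end \<circ> m) (inv \<rho>)"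
  have E: "?E \<rho> \<in> sets (cube N)" if "\<rho> permutes {1..N}" for \<rho>
    using that by (intro sets_ordered_above permutes_inv)
  have box: "word_box w \<in> sets (cube N)" for w
    unfolding word_box_def cube_def by (intro sets_PiM_I_finite) (auto simp: cell_def)
  have int: "integrable (cube N) (indicator A :: _ \<Rightarrow> real)" if "A \<in> sets (cube N)" for A
    using that by (simp add: integrable_indicator_iff cube.emeasure_eq_measure)
  have "fact N * measure (cube N) (ordered_above N (left_end \<circ> m) \<sigma>) =
      (\<Sum>\<rho> | \<rho> permutes {1..N}. measure (cube N) (?E \<rho>))"
  proof -
    have "(\<Sum>\<rho> | \<rho> permutes {1..N}. measure (cube N) (?E \<rho>)) =
        (\<Sum>\<rho> | \<rho> permutes {1..N}. measure (cube N) (ordered_above N (left_end \<circ> m) \<sigma>))"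
      using measure_ordered_above[OF permutes_inv] measure_ordered_above[OF \<sigma>]
      by (intro sum.cong) (metis mem_Collect_eq)+
    also have "\<dots> = fact N * measure (cube N) (ordered_above N (left_end \<circ> m) \<sigma>)"
      using card_permutations[of "{1..N}" N] by (simp del: One_nat_def)
    finally show ?thesis ..
  qed
  also have "\<dots> = (\<integral>y. (\<Sum>\<rho> | \<rho> permutes {1..N}. indicator (?E \<rho>) y) \<partial>cube N)"
    using E sets.sets_into_space[OF E]
    by (subst Bochner_Integration.integral_sum) (auto simp: int Int_absorb2)
  also have "\<dots> = (\<integral>y. (\<Sum>w\<in>words_above N m. indicator (word_box w) y) \<partial>cube N)"
  proof (rule integral_cong_AE)
    show "AE y in cube N. (\<Sum>\<rho> | \<rho> permutes {1..N}. indicator (?E \<rho>) y :: real) =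
        (\<Sum>w\<in>words_above N m. indicator (word_box w) y)"
      using AE_cube_inj_on AE_cube_component AE_space
      by eventually_elim (rule sum_ordered_above_eq_sum_word_box[OF m])
  qed (use E box in \<open>auto intro!: borel_measurable_sum\<close>)
  also have "\<dots> = (\<Sum>w\<in>words_above N m. measure (cube N) (word_box w))"
    using box sets.sets_into_space[OF box]
    by (subst Bochner_Integration.integral_sum) (auto simp: int Int_absorb2)
  also have "\<dots> = (\<Sum>w\<in>words_above N m. prod_list (map x w))"
    using words_above_subset[of N m] m(1) by (intro sum.cong measure_word_box) auto
  finally show ?thesis .
qed

text \<open>Each selection is a unit uniform point conditioned to exceed its left end, and
  independent conditionings amount to one conditioning on a box.\<close>

lemma reselect_measure_eq:
  "reselect_measure N x = uniform_measure (cube N) (\<Pi>\<^sub>E i\<in>{1..N}. {left_end i..})"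
proof -
  have "reselect_measure N x = (\<Pi>\<^sub>M i\<in>{1..N}. uniform_measure unit_uniform {left_end i..})"
    unfolding reselect_measure_def
    by (intro PiM_cong)
       (auto simp: uniform_measure_unit_uniform_atLeast left_end_bounds simp flip: left_end_def)
  also have "\<dots> = uniform_measure (cube N) (\<Pi>\<^sub>E i\<in>{1..N}. {left_end i..})"
    unfolding cube_def
    using left_end_bounds
    by (intro PiM_uniform_measure)
       (auto simp: unit_uniform.prob_space_axioms measure_unit_uniform_atLeast less_imp_le
         simp del: measure_uniform_measure)
  finally show ?thesis .
qed

text \<open>The normalizing constant of the conditioning, which becomes the denominator in both
  formulas.\<close>

lemma measure_start_box:
  "measure (cube N) (\<Pi>\<^sub>E i\<in>{1..N}. {left_end i..}) = (\<Prod>i=1..N. tail_sum N x i)"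
proof -
  have "measure unit_uniform {left_end i..} = tail_sum N x i" if "i \<in> {1..N}" for i
    using left_end_bounds[OF that] measure_unit_uniform_atLeast[of "left_end i"]
    by (simp add: left_end_def)
  thus ?thesis by (subst measure_cube_PiE) (auto intro!: prod.cong)
qed

text \<open>For ordered heights the bounds by position and by running maximum agree: the
  \<open>j\<close>-th smallest height is at least the height at the position attaining the maximum,
  and conversely that maximum is at least the position of \<open>j\<close>.\<close>

lemma start_box_Int_rank:
  assumes \<pi>: "\<pi> permutes {1..N}"
  shows "(\<Pi>\<^sub>E i\<in>{1..N}. {left_end i..}) \<inter> {y \<in> space (cube N). \<forall>i\<in>{1..N}. rank_of N y i = \<pi> i} =
    ordered_above N (left_end \<circ> btm_entry \<pi>) (inv \<pi>)"
proof -
  have inv: "inv \<pi> permutes {1..N}" using \<pi> by (rule permutes_inv)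
  have "(\<forall>i\<in>{1..N}. left_end i \<le> y i) \<longleftrightarrow>
      (\<forall>j\<in>{1..N}. left_end (btm_entry \<pi> j) \<le> y (inv \<pi> j))"
    if ordered: "\<forall>j\<in>{1..N}. \<forall>k\<in>{1..N}. j < k \<longrightarrow> y (inv \<pi> j) < y (inv \<pi> k)" for y
  proof
    assume L: "\<forall>i\<in>{1..N}. left_end i \<le> y i"
    show "\<forall>j\<in>{1..N}. left_end (btm_entry \<pi> j) \<le> y (inv \<pi> j)"
    proof
      fix j assume j: "j \<in> {1..N}"
      obtain k where k: "1 \<le> k" "k \<le> j" "btm_entry \<pi> j = inv \<pi> k"
        using btm_entry_obtain[of j \<pi>] j by auto
      hence kN: "k \<in> {1..N}" using j by auto
      have "y (inv \<pi> k) \<le> y (inv \<pi> j)"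
        using ordered kN j k by (cases "k = j") (auto intro: less_imp_le)
      moreover have "inv \<pi> k \<in> {1..N}" using permutes_in_image[OF inv] kN by blast
      hence "left_end (inv \<pi> k) \<le> y (inv \<pi> k)" using L by blast
      ultimately show "left_end (btm_entry \<pi> j) \<le> y (inv \<pi> j)" using k by simp
    qed
  next
    assume R: "\<forall>j\<in>{1..N}. left_end (btm_entry \<pi> j) \<le> y (inv \<pi> j)"
    show "\<forall>i\<in>{1..N}. left_end i \<le> y i"
    proof
      fix i assume i: "i \<in> {1..N}"
      hence \<pi>i: "\<pi> i \<in> {1..N}" using permutes_in_image[OF \<pi>] by blast
      hence "i \<le> btm_entry \<pi> (\<pi> i)"
        using inv_le_btm_entry[of "\<pi> i" "\<pi> i" \<pi>] by (simp add: permutes_inverses(2)[OF \<pi>])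
      hence "left_end i \<le> left_end (btm_entry \<pi> (\<pi> i))" using i by (intro left_end_mono) auto
      also have "\<dots> \<le> y i" using R \<pi>i by (metis permutes_inverses(2)[OF \<pi>])
      finally show "left_end i \<le> y i" .
    qed
  qed
  thus ?thesis
    unfolding ordered_above_def rank_of_eq_iff[OF \<pi>]
    by (auto simp: PiE_iff cube_def space_PiM extensional_def)
qed

text \<open>Both formulas of the theorem follow from this one by rewriting the sum over words. The
  probability is the volume of the ordered region inside the starting box, divided by the volume of
  the box.\<close>

lemma reselect_prob_eq:
  assumes \<pi>: "\<pi> permutes {1..N}"
  shows "reselect_prob N x \<pi> = (\<Sum>w\<in>words_above N (btm_entry \<pi>). prod_list (map x w)) /
    (fact N * (\<Prod>i=1..N. tail_sum N x i))"
proof -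
  let ?box = "\<Pi>\<^sub>E i\<in>{1..N}. {left_end i..}"
  let ?R = "{y \<in> space (cube N). \<forall>i\<in>{1..N}. rank_of N y i = \<pi> i}"
  have inv_in: "inv \<pi> j \<in> {1..N}" if "j \<in> {1..N}" for j
    using that permutes_in_image[OF permutes_inv[OF \<pi>]] by blast
  have [measurable]: "(\<lambda>y. y (inv \<pi> j)) \<in> borel_measurable (cube N)" if "j \<in> {1..N}" for j
    using that inv_in by (intro measurable_cube_component)
  have R: "?R \<in> sets (cube N)" unfolding rank_of_eq_iff[OF \<pi>] by measurable
  have "0 < (\<Prod>i=1..N. tail_sum N x i)" by (intro prod_pos) (auto intro: tail_sum_pos)
  hence box: "emeasure (cube N) ?box \<noteq> 0"
    by (simp only: cube.emeasure_eq_measure measure_start_box ennreal_eq_0_iff not_le)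
  have "space (reselect_measure N x) = space (cube N)" by (simp add: reselect_measure_eq)
  hence "reselect_prob N x \<pi> = measure (uniform_measure (cube N) ?box) ?R"
    unfolding reselect_prob_def by (simp add: reselect_measure_eq)
  also have "\<dots> = measure (cube N) (?box \<inter> ?R) / measure (cube N) ?box"
    using R box by (intro measure_uniform_measure) auto
  also have "\<dots> = measure (cube N) (ordered_above N (left_end \<circ> btm_entry \<pi>) (inv \<pi>)) /
      (\<Prod>i=1..N. tail_sum N x i)"
    by (simp only: start_box_Int_rank[OF \<pi>] measure_start_box)
  also have "\<dots> = (\<Sum>w\<in>words_above N (btm_entry \<pi>). prod_list (map x w)) /
      (fact N * (\<Prod>i=1..N. tail_sum N x i))"
    using btm_entry_bounds[OF \<pi>]
    by (subst measure_ordered_above_eq_sum_words[symmetric, OF _ _ permutes_inv[OF \<pi>]]) auto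
  finally show ?thesis .
qed

end

theorem theorem2p7:
  fixes N :: nat and x :: "nat \<Rightarrow> real" and \<pi> :: "nat \<Rightarrow> nat"
  assumes "N \<ge> 1"
    and "\<forall>i\<in>{1..<N}. 0 \<le> x i \<and> x i < 1"
    and "x N = 1 - (\<Sum>i=1..<N. x i)"
    and "x N > 0"
    and "\<pi> permutes {1..N}"
  shows "reselect_prob N x \<pi> =
           1 / (\<Prod>i=1..N. tail_sum N x i) *
             (\<Sum>p\<in>{p. dyck_path N p \<and> weakly_above N p (btm_path N \<pi>)}.
                (\<Prod>i=1..N. x (column_height p i)) / (\<Prod>j=1..N. fact (steps_at_height p j)))
       \<and> reselect_prob N x \<pi> =
           1 / (fact N * (\<Prod>i=1..N. tail_sum N x i)) *
             (\<Sum>w\<in>{w. dominates N w (btm_word N \<pi>)}. \<Prod>i<N. x (nat (w ! i)))"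
proof -
  interpret reselect N x
  proof
    show "0 \<le> x i" if "i \<in> {1..N}" for i using that assms by (cases "i = N") auto
    have "{1..N} = insert N {1..<N}" using assms(1) by auto
    thus "(\<Sum>i=1..N. x i) = 1" using assms(3) by simp
  qed (use assms in auto)
  show ?thesis
    unfolding sum_dyck_paths[OF assms(5)] sum_dominating_words[OF assms(5)]
    by (simp add: reselect_prob_eq[OF assms(5)])
qed

end
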